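(* Let $\phi(R_1, \ldots, R_n)$ be a factor all of whose arguments have the same range, and let $\boldsymbol S \subseteq \{R_1, \ldots, R_n\}$ be a subset of arguments such that $\phi$ is commutative with respect to $\boldsymbol S$. Then, in every bucket $b \in \mathcal B(\phi)$ with $|\phi(b)| > 1$, there exists a potential value $\varphi$ that occurs at least $|\boldsymbol S|$ times in $\phi(b)$.
   Context: A factor $\phi(R_1,\ldots,R_n)$ is a function that maps each assignment $(r_1,\ldots,r_n) \in \times_{i=1}^n \mathrm{range}(R_i)$ of its arguments (random variables $R_i$ with finite sets of possible values $\mathrm{range}(R_i)$) to a positive real number, called a potential. All arguments are assumed to have the same range $\mathcal V$. Commutative: $\phi$ is commutative with respect to $\boldsymbol S \subseteq \{R_1, \ldots, R_n\}$ if for all $(r_1, \ldots, r_n) \in \times_{i=1}^n \mathrm{range}(R_i)$ it holds that $\phi(r_1, \ldots, r_n) = \phi(r_{\pi(1)}, \ldots, r_{\pi(n)})$ for all permutations $\pi$ of $\{1, \ldots, n\}$ with $\pi(i) = i$ for all $R_i \notin \boldsymbol S$. Bucket: a bucket $b$ entailed by $\phi$ (i.e., by its full argument set) is a set of pairs $\{(v, n_v)\}_{v \in \mathcal V}$ with $n_v \in \mathbb{N}$ (zero allowed) and $\sum_v n_v = n$; it represents all assignments $(r_1,\ldots,r_n)$ in which each value $v$ occurs exactly $n_v$ times. $\phi(b)$ denotes the multiset of potentials to which $\phi$ maps the assignments represented by $b$ (one element per assignment), and $|\phi(b)|$ is its size with multiplicity. $\mathcal B(\phi)$ denotes the set of all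 buckets entailed by $\phi$. *)

theory Defs
  imports Complex_Main "HOL-Library.FuncSet" "HOL-Library.Multiset" "HOL-Combinatorics.Permutations"
begin

text \<open>
  The arguments of a factor are given by an enumeration \<open>R\<close> of random variables, of which only
  \<open>R 1, \<dots>, R n\<close> matter; \<open>rng X\<close> is the set of possible values of the random variable \<open>X\<close>.
  An assignment \<open>(r\<^sub>1, \<dots>, r\<^sub>n)\<close> is an extensional function on \<open>{1..n}\<close>, so that distinct
  functions in \<open>assignments n R rng\<close> are distinct tuples.
\<close>

definition assignments :: "nat \<Rightarrow> (nat \<Rightarrow> 'r) \<Rightarrow> ('r \<Rightarrow> 'v set) \<Rightarrow> (nat \<Rightarrow> 'v) set" where
  "assignments n R rng = (\<Pi>\<^sub>E i\<in>{1..n}. rng (R i))"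

definition factor ::
  "nat \<Rightarrow> (nat \<Rightarrow> 'r) \<Rightarrow> ('r \<Rightarrow> 'v set) \<Rightarrow> ((nat \<Rightarrow> 'v) \<Rightarrow> real) \<Rightarrow> bool" where
  "factor n R rng \<phi> \<longleftrightarrow>
     inj_on R {1..n} \<and>
     (\<forall>i\<in>{1..n}. finite (rng (R i))) \<and>
     (\<forall>r\<in>assignments n R rng. \<phi> r > 0)"

text \<open>
  Only meaningful when all arguments have the same range: otherwise the permuted tuple need not
  be an assignment.
\<close>

definition commutative_wrt ::
  "nat \<Rightarrow> (nat \<Rightarrow> 'r) \<Rightarrow> ('r \<Rightarrow> 'v set) \<Rightarrow> ((nat \<Rightarrow> 'v) \<Rightarrow> real) \<Rightarrow> 'r set \<Rightarrow> bool" where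
  "commutative_wrt n R rng \<phi> S \<longleftrightarrow>
     (\<forall>r\<in>assignments n R rng. \<forall>\<pi>.
        \<pi> permutes {1..n} \<and> (\<forall>i\<in>{1..n}. R i \<notin> S \<longrightarrow> \<pi> i = i) \<longrightarrow>
        \<phi> r = \<phi> (\<lambda>i\<in>{1..n}. r (\<pi> i)))"

definition buckets :: "nat \<Rightarrow> 'v set \<Rightarrow> ('v \<times> nat) set set" where
  "buckets n V = {{(v, c v) |v. v \<in> V} |c. (\<Sum>v\<in>V. c v) = n}"

definition represented ::
  "nat \<Rightarrow> (nat \<Rightarrow> 'r) \<Rightarrow> ('r \<Rightarrow> 'v set) \<Rightarrow> ('v \<times> nat) set \<Rightarrow> (nat \<Rightarrow> 'v) set" where
  "represented n R rng b =
     {r \<in> assignments n R rng. \<forall>(v, m)\<in>b. card {i \<in> {1..n}. r i = v} = m}"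

text \<open>
  The multiset of potentials of a bucket, with one element per represented assignment. For finite
  ranges \<open>represented n R rng b\<close> is finite, so \<open>mset_set\<close> does not degenerate.
\<close>

definition bucket_potentials ::
  "nat \<Rightarrow> (nat \<Rightarrow> 'r) \<Rightarrow> ('r \<Rightarrow> 'v set) \<Rightarrow> ((nat \<Rightarrow> 'v) \<Rightarrow> real) \<Rightarrow> ('v \<times> nat) set \<Rightarrow> real multiset"
  where
  "bucket_potentials n R rng \<phi> b = image_mset \<phi> (mset_set (represented n R rng b))"

end

theory Submission
  imports Defs
begin

text \<open>
  A bucket with two assignments contains a non-constant one, and a single transposition makes it
  non-constant on the positions of \<open>S\<close>. Fix a value \<open>v\<close> taken there, and let \<open>A\<close> and \<open>B\<close> be the
  positions of \<open>S\<close> with value \<open>v\<close> and with another value. The transpositions of some \<open>a \<in> A\<close> with some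
  \<open>b \<in> B\<close> yield \<open>|A| |B|\<close> distinct assignments, all different from the original one and all of the
  same potential by commutativity, and \<open>|A| |B| + 1 \<ge> |A| + |B| = |S|\<close> because \<open>A\<close> and \<open>B\<close> are
  nonempty.
\<close>

lemma finite_represented:
  assumes "\<And>i. i \<in> {1..n} \<Longrightarrow> finite (rng (R i))"
  shows "finite (represented n R rng b)"
proof -
  have "finite (assignments n R rng)"
    unfolding assignments_def using assms by (intro finite_PiE) auto
  then show ?thesis
    by (rule rev_finite_subset) (auto simp: represented_def)
qed

text \<open>For each value \<open>v\<close>, \<open>\<pi>\<close> maps the positions of
  \<open>v\<close> in the permuted tuple bijectively onto those in \<open>r\<close>, so all counts
  survive. The common range keeps the permuted tuple an assignment.\<close>

lemma represented_permute:
  assumes V: "\<forall>i\<in>{1..n}. rng (R i) = V"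
    and r: "r \<in> represented n R rng b"
    and \<pi>: "\<pi> permutes {1..n}"
  shows "(\<lambda>i\<in>{1..n}. r (\<pi> i)) \<in> represented n R rng b"
proof -
  have in_range: "\<pi> i \<in> {1..n} \<longleftrightarrow> i \<in> {1..n}" for i
    using permutes_in_image[OF \<pi>] .
  have "(\<lambda>i\<in>{1..n}. r (\<pi> i)) \<in> assignments n R rng"
    unfolding assignments_def
  proof (rule restrict_PiE_iff[THEN iffD2], rule ballI)
    fix i assume i: "i \<in> {1..n}"
    have "r (\<pi> i) \<in> rng (R (\<pi> i))"
      using r i in_range[of i] by (auto simp: represented_def assignments_def)
    then show "r (\<pi> i) \<in> rng (R i)"
      using V i in_range[of i] by metis
  qed
  moreover have "card {i \<in> {1..n}. (\<lambda>i\<in>{1..n}. r (\<pi> i)) i = v} = card {i \<in> {1..n}. r i = v}" for v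
  proof -
    have "\<pi> ` {i \<in> {1..n}. r (\<pi> i) = v} = {i \<in> {1..n}. r i = v}"
    proof (intro equalityI subsetI)
      fix j assume j: "j \<in> {i \<in> {1..n}. r i = v}"
      obtain i where "j = \<pi> i" using permutes_surj[OF \<pi>] by (metis surjD)
      then show "j \<in> \<pi> ` {i \<in> {1..n}. r (\<pi> i) = v}"
        using j in_range[of i] by blast
    qed (use in_range in auto)
    moreover have "{i \<in> {1..n}. (\<lambda>i\<in>{1..n}. r (\<pi> i)) i = v} = {i \<in> {1..n}. r (\<pi> i) = v}"
      by auto
    ultimately show ?thesis
      using card_image[OF permutes_inj_on[OF \<pi>], of "{i \<in> {1..n}. r (\<pi> i) = v}"] by simp
  qed
  ultimately show ?thesis
    using r unfolding represented_def mem_Collect_eq by simp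
qed

text \<open>A constant assignment is alone in its bucket: its value must occur \<open>n\<close>
  times, which leaves no position for another value.\<close>

lemma represented_nonconstant:
  assumes V: "\<forall>i\<in>{1..n}. rng (R i) = V"
    and b: "b \<in> buckets n V"
    and r: "r \<in> represented n R rng b" and s: "s \<in> represented n R rng b" and "r \<noteq> s"
  shows "\<exists>j\<in>{1..n}. r j \<noteq> w"
proof (rule ccontr)
  assume "\<not> ?thesis"
  then have const: "r j = w" if "j \<in> {1..n}" for j using that by auto
  have "r \<in> extensional {1..n}" "s \<in> extensional {1..n}"
    using r s by (auto simp: represented_def assignments_def PiE_def)
  with \<open>r \<noteq> s\<close> obtain i where i: "i \<in> {1..n}" "s i \<noteq> r i"
    by (metis extensionalityI)
  \<comment> \<open>A bucket prescribes counts only for values in \<open>V\<close>, whereas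
    \<open>w\<close> is arbitrary; the position \<open>i\<close> shows that \<open>w\<close> lies in
    \<open>V\<close>.\<close>
  have "r i \<in> V"
    using r V i(1) by (auto simp: represented_def assignments_def)
  then have "w \<in> V" using const[OF i(1)] by simp
  then obtain m where "(w, m) \<in> b"
    using b by (auto simp: buckets_def)
  then have "card {i \<in> {1..n}. t i = w} = m" if "t \<in> represented n R rng b" for t
    using bspec[of b "\<lambda>(v, m). card {i \<in> {1..n}. t i = v} = m" "(w, m)"] that
    unfolding represented_def by simp
  with r s have "card {i \<in> {1..n}. s i = w} = card {i \<in> {1..n}. r i = w}" by metis
  also have "{i \<in> {1..n}. r i = w} = {1..n}"
    using const by blast
  finally have "{i \<in> {1..n}. s i = w} = {1..n}"
    by (intro card_subset_eq) auto
  then have "s i = w" using i(1) by blast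
  then show False using i const by simp
qed

text \<open>If \<open>r\<close> agrees at \<open>p\<close> and \<open>q\<close>, some position
  \<open>k\<close> holds another value; swapping \<open>k\<close> with \<open>q\<close> brings that
  value to \<open>q\<close> and leaves \<open>p\<close> untouched.\<close>

lemma represented_nonconstant_on:
  assumes V: "\<forall>i\<in>{1..n}. rng (R i) = V"
    and b: "b \<in> buckets n V"
    and r: "r \<in> represented n R rng b" and s: "s \<in> represented n R rng b" and "r \<noteq> s"
    and p: "p \<in> {1..n}" and q: "q \<in> {1..n}" and "p \<noteq> q"
  shows "\<exists>t\<in>represented n R rng b. t p \<noteq> t q"
proof (cases "r p = r q")
  case True
  obtain k where k: "k \<in> {1..n}" "r k \<noteq> r p"
    using represented_nonconstant[OF V b r s \<open>r \<noteq> s\<close>] by blast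
  have "(\<lambda>i\<in>{1..n}. r (transpose k q i)) \<in> represented n R rng b"
    using k q by (intro represented_permute[OF V r] permutes_swap_id)
  moreover have "k \<noteq> p" using k by auto
  ultimately show ?thesis
    using k p q \<open>p \<noteq> q\<close> by (intro bexI) auto
qed (use r in blast)

text \<open>\<open>U\<close> stands for the assignments of the bucket that share the potential of
  \<open>r\<close>.\<close>

lemma card_le_swaps:
  fixes r :: "nat \<Rightarrow> 'v" and N T :: "nat set"
  assumes T: "T \<subseteq> N" "finite T" and r: "r \<in> extensional N"
    and p: "p \<in> T" and q: "q \<in> T" and pq: "r p \<noteq> r q"
    and U: "finite U" "\<And>a b. a \<in> T \<Longrightarrow> b \<in> T \<Longrightarrow> (\<lambda>i\<in>N. r (transpose a b i)) \<in> U"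
  shows "card T \<le> card U"
proof -
  define A where "A = {i \<in> T. r i = r p}"
  define B where "B = {i \<in> T. r i \<noteq> r p}"
  define f where "f = (\<lambda>(a, b). \<lambda>i\<in>N. r (transpose a b i))"
  have fin: "finite A" "finite B" using T by (auto simp: A_def B_def)
  have ne: "p \<in> A" "q \<in> B" using p q pq by (auto simp: A_def B_def)
  txt \<open>A swap is recovered from its result: \<open>a\<close> and \<open>b\<close> are the positions that lose, respectively
    gain, the value \<open>r p\<close>.\<close>
  have val: "f (a, b) i = r p \<longleftrightarrow> i \<noteq> a \<and> (i = b \<or> r i = r p)"
    if "a \<in> A" "b \<in> B" "i \<in> N" for a b i
    using that by (auto simp: f_def A_def B_def transpose_def)
  have inj: "inj_on f (A \<times> B)"
  proof (rule inj_onI, clarify)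
    fix a b c d assume h: "a \<in> A" "b \<in> B" "c \<in> A" "d \<in> B" "f (a, b) = f (c, d)"
    have "i \<noteq> a \<and> (i = b \<or> r i = r p) \<longleftrightarrow> i \<noteq> c \<and> (i = d \<or> r i = r p)" if "i \<in> N" for i
      using val[OF h(1,2) that] val[OF h(3,4) that] h(5) by metis
    \<comment> \<open>At \<open>i = a\<close> the left side is false, and \<open>r a = r p\<close>
      then forces \<open>a = c\<close>. At \<open>i = b\<close> it is true, and
      \<open>r b \<noteq> r p\<close> forces \<open>b = d\<close>.\<close>
    then show "a = c \<and> b = d"
      using h(1-4) T(1) unfolding A_def B_def by blast
  qed
  have "f (a, b) \<noteq> r" if "a \<in> A" "b \<in> B" for a b
    using val[OF that, of a] that T(1) unfolding A_def by auto
  then have notin: "r \<notin> f ` (A \<times> B)" by fastforce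
  \<comment> \<open>The trivial swap puts \<open>r\<close> itself into \<open>U\<close>, which
    supplies the summand 1 beyond the proper swaps.\<close>
  have "(\<lambda>i\<in>N. r (transpose p p i)) = r"
    using r by (simp add: extensional_restrict)
  then have "r \<in> U" using U(2)[OF p p] by simp
  then have "insert r (f ` (A \<times> B)) \<subseteq> U"
    using U(2) by (auto simp: f_def A_def B_def)
  then have "card (insert r (f ` (A \<times> B))) \<le> card U"
    using U(1) by (rule card_mono[rotated])
  then have "card A * card B + 1 \<le> card U"
    using notin fin by (simp add: card_image[OF inj] card_cartesian_product)
  moreover have "card T = card A + card B"
  proof -
    have "T = A \<union> B" "A \<inter> B = {}" by (auto simp: A_def B_def)
    then show ?thesis using fin by (simp add: card_Un_disjoint)
  qed
  moreover have "card A + card B \<le> card A * card B + 1"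
  proof -
    \<comment> \<open>In these terms the right side exceeds the left by
      \<open>x * y\<close>.\<close>
    obtain x y where "card A = Suc x" "card B = Suc y"
      using ne fin by (metis card_gt_0_iff empty_iff gr0_implies_Suc)
    then show ?thesis by simp
  qed
  ultimately show ?thesis by linarith
qed

theorem corollary5:
  fixes n :: nat
    and R :: "nat \<Rightarrow> 'r"
    and rng :: "'r \<Rightarrow> 'v set"
    and V :: "'v set"
    and \<phi> :: "(nat \<Rightarrow> 'v) \<Rightarrow> real"
    and S :: "'r set"
  assumes "factor n R rng \<phi>"
    and "\<forall>i\<in>{1..n}. rng (R i) = V"
    and "S \<subseteq> R ` {1..n}"
    and "commutative_wrt n R rng \<phi> S"
  shows "\<forall>b\<in>buckets n V. size (bucket_potentials n R rng \<phi> b) > 1 \<longrightarrow>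
           (\<exists>x\<in>#bucket_potentials n R rng \<phi> b. count (bucket_potentials n R rng \<phi> b) x \<ge> card S)"
proof (intro ballI impI)
  fix b assume b: "b \<in> buckets n V" and size: "size (bucket_potentials n R rng \<phi> b) > 1"
  note V = assms(2)
  let ?P = "represented n R rng b"
  \<comment> \<open>Swaps act on positions rather than variables; injectivity of \<open>R\<close>
    gives \<open>T\<close> the size of \<open>S\<close>.\<close>
  define T where "T = {i \<in> {1..n}. R i \<in> S}"
  have "inj_on R T"
    using assms(1) by (auto simp: factor_def T_def intro: inj_on_subset)
  moreover have "R ` T = S" using assms(3) by (auto simp: T_def)
  ultimately have cardT: "card T = card S" by (metis card_image)
  have finP: "finite ?P"
    using assms(1) by (intro finite_represented) (auto simp: factor_def)
  then have mem: "x \<in># bucket_potentials n R rng \<phi> b \<longleftrightarrow> x \<in> \<phi> ` ?P" for x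
    by (simp add: bucket_potentials_def)
  have count: "count (bucket_potentials n R rng \<phi> b) x = card {t \<in> ?P. \<phi> t = x}" for x
    using finP by (simp add: bucket_potentials_def count_image_mset_eq_card_vimage)
  have "\<not> card ?P \<le> 1" using size finP by (simp add: bucket_potentials_def)
  then obtain r s where rs: "r \<in> ?P" "s \<in> ?P" "r \<noteq> s"
    using finP by (metis One_nat_def card_le_Suc0_iff_eq)
  have "\<exists>t\<in>?P. card T \<le> card {u \<in> ?P. \<phi> u = \<phi> t}"
  proof (cases "card T \<le> 1")
    \<comment> \<open>Without two positions to swap, one occurrence of any potential of the bucket
      is enough.\<close>
    case True
    have "{u \<in> ?P. \<phi> u = \<phi> r} \<noteq> {}" using rs by blast
    then have "card {u \<in> ?P. \<phi> u = \<phi> r} > 0"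
      using finP by (simp add: card_gt_0_iff)
    with True rs show ?thesis by (intro bexI[of _ r]) auto
  next
    case False
    have finT: "finite T" by (simp add: T_def)
    with False obtain p q where pq: "p \<in> T" "q \<in> T" "p \<noteq> q"
      by (metis One_nat_def card_le_Suc0_iff_eq)
    then obtain t where t: "t \<in> ?P" "t p \<noteq> t q"
      using represented_nonconstant_on[OF V b rs, of p q] unfolding T_def by blast
    have "card T \<le> card {u \<in> ?P. \<phi> u = \<phi> t}"
    proof (rule card_le_swaps[where N = "{1..n}", OF _ finT _ pq(1,2) t(2)])
      show "T \<subseteq> {1..n}" by (auto simp: T_def)
      show "t \<in> extensional {1..n}"
        using t by (auto simp: represented_def assignments_def PiE_def)
      show "finite {u \<in> ?P. \<phi> u = \<phi> t}" using finP by simp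
      fix a c assume ac: "a \<in> T" "c \<in> T"
      then have perm: "transpose a c permutes {1..n}"
        by (intro permutes_swap_id) (auto simp: T_def)
      \<comment> \<open>Only positions in \<open>T\<close> move, so commutativity applies to the
        swap.\<close>
      have "\<forall>i\<in>{1..n}. R i \<notin> S \<longrightarrow> transpose a c i = i"
        using ac by (auto simp: T_def transpose_def)
      moreover have "t \<in> assignments n R rng" using t by (simp add: represented_def)
      ultimately have "\<phi> t = \<phi> (\<lambda>i\<in>{1..n}. t (transpose a c i))"
        using assms(4) perm unfolding commutative_wrt_def by blast
      then show "(\<lambda>i\<in>{1..n}. t (transpose a c i)) \<in> {u \<in> ?P. \<phi> u = \<phi> t}"
        using represented_permute[OF V t(1) perm] by simp
    qed
    with t(1) show ?thesis by blast
  qed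
  then show "\<exists>x\<in>#bucket_potentials n R rng \<phi> b. card S \<le> count (bucket_potentials n R rng \<phi> b) x"
    using mem count cardT by auto
qed

end
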